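(* Let $\mathscr{A}$ be a complex Banach algebra with unit $1$. Let $a\in\mathscr{A}$ and let $p,q,p',q'\in\mathscr{A}$ be idempotents such that $a^{(2,l)}_{p,q}$ exists, and put $\kappa=\|a\|\,\|a^{(2,l)}_{p,q}\|$. If $\|p-p'\|<\dfrac{1}{(1+\kappa)^2}$ and $\|q-q'\|<\dfrac{1}{3+\kappa}$, then $a^{(2,l)}_{p',q'}$ exists and $$\frac{\|a^{(2,l)}_{p',q'}-a^{(2,l)}_{p,q}\|}{\|a^{(2,l)}_{p,q}\|}\le\frac{(1+\kappa)(\|p-p'\|+\|q-q'\|)}{1-(1+\kappa)\|p-p'\|-\kappa\|q-q'\|},$$ $$\|a^{(2,l)}_{p',q'}\|\le\frac{(1+\|q-q'\|)\,\|a^{(2,l)}_{p,q}\|}{1-(1+\kappa)\|p-p'\|-\kappa\|q-q'\|}.$$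
   Context: For $x\in\mathscr{A}$ let $R_r(x)=\{xy: y\in\mathscr{A}\}$ and $K_r(x)=\{y\in\mathscr{A}: xy=0\}$. For $a\in\mathscr{A}$ and idempotents $p,q\in\mathscr{A}$, the $(p,q,l)$-outer generalized inverse $a^{(2,l)}_{p,q}$ is an element $b\in\mathscr{A}$ with $bab=b$, $R_r(b)=R_r(p)$, $K_r(b)=R_r(q)$; it is unique if it exists. *)

theory Defs
  imports Complex_Main
begin

text \<open>
  The submultiplicative norm makes multiplication continuous; \<open>norm 1 = 1\<close> is not
  required (so \<open>real_normed_algebra_1\<close> is not used).  The real scalar multiplication of
  the class hierarchy is the restriction of the complex one.
\<close>

class complex_banach_algebra_1 = real_normed_algebra + ring_1 + banach +
  fixes scaleC :: "complex \<Rightarrow> 'a \<Rightarrow> 'a" (infixr \<open>*\<^sub>C\<close> 75)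
  assumes scaleC_add_right: "c *\<^sub>C (x + y) = c *\<^sub>C x + c *\<^sub>C y"
    and scaleC_add_left: "(c + d) *\<^sub>C x = c *\<^sub>C x + d *\<^sub>C x"
    and scaleC_scaleC: "c *\<^sub>C d *\<^sub>C x = (c * d) *\<^sub>C x"
    and scaleC_of_real: "complex_of_real r *\<^sub>C x = scaleR r x"
    and mult_scaleC_left: "(c *\<^sub>C x) * y = c *\<^sub>C (x * y)"
    and mult_scaleC_right: "x * (c *\<^sub>C y) = c *\<^sub>C (x * y)"
    and norm_scaleC: "norm (c *\<^sub>C x) = cmod c * norm x"

definition R_r :: "'a::ring_1 \<Rightarrow> 'a set" where
  "R_r x = {x * y | y. True}"

definition K_r :: "'a::ring_1 \<Rightarrow> 'a set" where
  "K_r x = {y. x * y = 0}"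

definition is_outer_inv_l :: "'a::ring_1 \<Rightarrow> 'a \<Rightarrow> 'a \<Rightarrow> 'a \<Rightarrow> bool" where
  "is_outer_inv_l a p q b \<longleftrightarrow> b * a * b = b \<and> R_r b = R_r p \<and> K_r b = R_r q"

definition outer_inv_l_exists :: "'a::ring_1 \<Rightarrow> 'a \<Rightarrow> 'a \<Rightarrow> bool" where
  "outer_inv_l_exists a p q \<longleftrightarrow> (\<exists>b. is_outer_inv_l a p q b)"

definition outer_inv_l :: "'a::ring_1 \<Rightarrow> 'a \<Rightarrow> 'a \<Rightarrow> 'a" where
  "outer_inv_l a p q = (THE b. is_outer_inv_l a p q b)"

lemma is_outer_inv_l_unique:
  assumes "is_outer_inv_l a p q b" and "is_outer_inv_l a p q c"
  shows "b = c"
proof -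
  have "c \<in> R_r c" unfolding R_r_def by (metis (mono_tags, lifting) mem_Collect_eq mult_1_right)
  then have "c \<in> R_r b" using assms by (simp add: is_outer_inv_l_def)
  then obtain y where "c = b * y" by (auto simp: R_r_def)
  then have 1: "b * a * c = c"
    using assms(1) by (metis is_outer_inv_l_def mult.assoc)
  have "1 - a * c \<in> K_r c"
  proof -
    have "c * a * c = c" using assms(2) by (simp add: is_outer_inv_l_def)
    then show ?thesis by (simp add: K_r_def algebra_simps)
  qed
  then have "1 - a * c \<in> K_r b" using assms by (simp add: is_outer_inv_l_def)
  then have "b = b * a * c" by (simp add: K_r_def algebra_simps)
  with 1 show ?thesis by simp
qed

lemma is_outer_inv_l_outer_inv_l:
  "outer_inv_l_exists a p q \<Longrightarrow> is_outer_inv_l a p q (outer_inv_l a p q)"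
  unfolding outer_inv_l_exists_def outer_inv_l_def
  by (metis is_outer_inv_l_unique the_equality)

end

theory Submission
  imports Defs
begin

text \<open>
  Write \<open>b\<close> for the given inverse, \<open>s = \<parallel>p - p'\<parallel>\<close> and \<open>t = \<parallel>q - q'\<parallel>\<close>.
  Existence is obtained by moving the range and the kernel one after the other: if
  \<open>1 - (1 - b a) (p' - p)\<close> has inverse \<open>u\<close>, then \<open>u b\<close> has range \<open>R_r p'\<close> and the
  kernel of \<open>b\<close>, and the kernel is moved dually by a factor on the right.
  All invertibility comes from Neumann series; the first step enlarges \<open>\<kappa>\<close> to at most
  \<open>1 + \<kappa>\<close>, so that the bound on \<open>t\<close> makes the second one possible.
  The estimates follow from the fixed point equation \<open>b' = X b' + b (1 - q' + q)\<close> with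
  \<open>X = (1 - b a) (p' - p) + b (q' - q) a\<close>, whose norm is at most \<open>(1 + \<kappa>) s + \<kappa> t\<close>.
\<close>

section \<open>Equational form of the outer inverse\<close>

text \<open>An idempotent fixes exactly the elements of its range, and \<open>b * a * b = b\<close>
  gives \<open>K_r b = R_r (1 - a * b)\<close>. So each inclusion between the sets amounts to one
  equation, and the rest of the algebra needs no sets.\<close>

lemma is_outer_inv_l_iff:
  fixes a b p q :: "'a::ring_1"
  assumes "p * p = p" and "q * q = q"
  shows "is_outer_inv_l a p q b \<longleftrightarrow>
    b * a * b = b \<and> p * b = b \<and> b * a * p = p \<and> b * q = 0 \<and> q * (1 - a * b) = 1 - a * b"
    (is "_ \<longleftrightarrow> ?R")
proof
  assume "is_outer_inv_l a p q b"
  then have bab: "b * a * b = b" and R: "R_r b = R_r p" and K: "K_r b = R_r q"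
    by (auto simp: is_outer_inv_l_def)
  have self: "x \<in> R_r x" for x :: 'a
    unfolding R_r_def by (metis (mono_tags, lifting) mem_Collect_eq mult_1_right)
  obtain y where "b = p * y" using self[of b] R by (auto simp: R_r_def)
  then have 1: "p * b = b" using assms(1) by (metis mult.assoc)
  obtain y where "p = b * y" using self[of p] R by (auto simp: R_r_def)
  then have 2: "b * a * p = p" using bab by (metis mult.assoc)
  have 3: "b * q = 0" using self[of q] K by (auto simp: K_r_def)
  have "1 - a * b \<in> K_r b" using bab by (simp add: K_r_def algebra_simps)
  then obtain y where "1 - a * b = q * y" using K by (auto simp: R_r_def)
  then have 4: "q * (1 - a * b) = 1 - a * b" using assms(2) by (metis mult.assoc)
  show ?R using bab 1 2 3 4 by blast
next
  assume ?R
  then have bab: "b * a * b = b" and 1: "p * b = b" and 2: "b * a * p = p"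
    and 3: "b * q = 0" and 4: "q * (1 - a * b) = 1 - a * b" by auto
  have "b * y \<in> R_r p" for y
    using 1 by (auto simp: R_r_def) (metis mult.assoc)
  moreover have "p * y \<in> R_r b" for y
    using 2 by (auto simp: R_r_def) (metis mult.assoc)
  ultimately have R: "R_r b = R_r p" by (auto simp: R_r_def)
  have "q * y \<in> K_r b" for y
    using 3 by (simp add: K_r_def flip: mult.assoc)
  moreover have "y \<in> R_r q" if "b * y = 0" for y
  proof -
    have "y = (1 - a * b) * y" using that by (simp add: algebra_simps)
    also have "\<dots> = q * ((1 - a * b) * y)" using 4 by (metis mult.assoc)
    finally show ?thesis by (auto simp: R_r_def)
  qed
  ultimately have K: "K_r b = R_r q" by (auto simp: K_r_def R_r_def)
  show "is_outer_inv_l a p q b" using bab R K by (simp add: is_outer_inv_l_def)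
qed

section \<open>Moving the range and the kernel\<close>

text \<open>The idempotent \<open>e = b * a\<close> has range \<open>R_r p\<close>, and the factor
  \<open>v\<close> inverted by \<open>u\<close> satisfies \<open>e * v = e\<close> and
  \<open>v * p' = e * p'\<close>. Hence \<open>e * u = e\<close>, which keeps the outer inverse
  equation and the kernel, while \<open>u\<close> sends \<open>e * p'\<close> to
  \<open>p'\<close>.\<close>

lemma is_outer_inv_l_change_range:
  fixes a b p q p' u z :: "'a::ring_1"
  assumes "p * p = p" and "q * q = q" and "p' * p' = p'"
    and b: "is_outer_inv_l a p q b"
    and u: "(1 - (1 - b * a) * (p' - p)) * u = 1" "u * (1 - (1 - b * a) * (p' - p)) = 1"
    and z: "(1 - (p - p') * (b * a)) * z = 1"
  shows "is_outer_inv_l a p' q (u * b)"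
proof -
  define e where "e = b * a"
  define v where "v = 1 - (1 - e) * (p' - p)"
  have bab: "b * a * b = b" and pb: "p * b = b" and ep: "e * p = p"
    and bq: "b * q = 0" and qf: "q * (1 - a * b) = 1 - a * b"
    using b unfolding is_outer_inv_l_iff[OF assms(1,2)] e_def by auto
  have ee: "e * e = e" and eb: "e * b = b" and pe: "p * e = e"
    using bab pb by (simp_all add: e_def flip: mult.assoc)
  have uv: "v * u = 1" "u * v = 1" using u by (simp_all add: v_def e_def)
  have "e * v = e" by (simp add: v_def algebra_simps ee flip: mult.assoc)
  then have eu: "e * u = e" using uv by (metis mult.assoc mult_1_right)
  have "v * p' = e * p'"
    by (simp add: v_def algebra_simps ep assms(3))
  then have uep: "u * (e * p') = p'" using uv by (metis mult.assoc mult_1_left)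
  \<comment> \<open>The second invertibility hypothesis enters here: it gives \<open>e\<close> as a
    right multiple of \<open>e * p'\<close>, so \<open>u * e\<close> is a right multiple of
    \<open>p'\<close> and the new range lies inside \<open>R_r p'\<close>.\<close>
  have "e * (p' * e) = e * (1 - (p - p') * e)"
    by (simp add: algebra_simps pe ee)
  then have "e * p' * e * z = e" using z by (metis e_def mult.assoc mult_1_right)
  then have "u * e = u * (e * p') * (e * z)" by (simp add: mult.assoc)
  then have "u * e = p' * (e * z)" by (simp add: uep)
  then have pue: "p' * (u * e) = u * e" using assms(3) by (metis mult.assoc)
  have "u * b * a * (u * b) = u * (e * u) * b" by (simp add: e_def mult.assoc)
  then have 1: "u * b * a * (u * b) = u * b" by (simp add: eu mult.assoc eb)
  have 2: "p' * (u * b) = u * b" using pue eb by (metis mult.assoc)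
  have 3: "u * b * a * p' = p'" using uep by (simp add: e_def mult.assoc)
  have 4: "u * b * q = 0" using bq by (simp add: mult.assoc)
  have "b * (a * (u * b)) = b" using eu eb by (metis e_def mult.assoc)
  then have "b * (1 - a * (u * b)) = 0" by (simp add: right_diff_distrib)
  then have "1 - a * (u * b) = (1 - a * b) * (1 - a * (u * b))"
    by (simp add: left_diff_distrib mult.assoc)
  then have 5: "q * (1 - a * (u * b)) = 1 - a * (u * b)" using qf by (metis mult.assoc)
  show ?thesis unfolding is_outer_inv_l_iff[OF assms(3,2)] using 1 2 3 4 5 by blast
qed

text \<open>This is the previous argument with products reversed: \<open>1 - q\<close> plays the
  role of \<open>p\<close>, and \<open>c = a * b\<close> that of \<open>b * a\<close>. The factor
  now satisfies \<open>v * c = c\<close> and \<open>(1 - q') * v = (1 - q') * c\<close>.\<close>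

lemma is_outer_inv_l_change_kernel:
  fixes a b p q q' u z :: "'a::ring_1"
  assumes "p * p = p" and "q * q = q" and "q' * q' = q'"
    and b: "is_outer_inv_l a p q b"
    and u: "(1 - (q - q') * (1 - a * b)) * u = 1" "u * (1 - (q - q') * (1 - a * b)) = 1"
    and z: "z * (1 - a * b * (q' - q)) = 1"
  shows "is_outer_inv_l a p q' (b * u)"
proof -
  define c where "c = a * b"
  define v where "v = 1 - (q - q') * (1 - c)"
  have bab: "b * a * b = b" and pb: "p * b = b" and ep: "b * a * p = p"
    and bq: "b * q = 0" and qf: "q * (1 - c) = 1 - c"
    using b unfolding is_outer_inv_l_iff[OF assms(1,2)] c_def by auto
  have bc: "b * c = b" using bab by (simp add: c_def mult.assoc)
  then have cc: "c * c = c" by (metis c_def mult.assoc)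
  have cq: "c * q = 0" by (simp add: c_def mult.assoc bq)
  have uv: "v * u = 1" "u * v = 1" using u by (simp_all add: v_def c_def)
  have "v * c = c" by (simp add: v_def mult.assoc left_diff_distrib cc)
  then have uc: "u * c = c" using uv by (metis mult.assoc mult_1_left)
  have v: "v = c + q' * (1 - c)" by (simp add: v_def left_diff_distrib qf)
  have "(1 - q') * (q' * (1 - c)) = 0"
    by (simp add: left_diff_distrib assms(3) flip: mult.assoc)
  then have "(1 - q') * v = (1 - q') * c" by (simp add: v distrib_left)
  then have qcu: "(1 - q') * (c * u) = 1 - q'" using uv by (metis mult.assoc mult_1_right)
  \<comment> \<open>With the left inverse \<open>z\<close>, this turns \<open>c * u\<close> into a
    left multiple of \<open>1 - q'\<close>, so that it annihilates \<open>q'\<close>.\<close>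
  have "(1 - c * (q' - q)) * c = c * (1 - q') * c"
    by (simp add: right_diff_distrib left_diff_distrib cc cq)
  then have "c = z * (c * (1 - q') * c)" using z by (metis c_def mult.assoc mult_1_left)
  then have "c * u = z * c * ((1 - q') * (c * u))" by (metis mult.assoc)
  then have "c * u = z * c * (1 - q')" by (simp only: qcu)
  then have "c * u * q' = 0" by (simp add: mult.assoc left_diff_distrib assms(3))
  then have 4: "b * u * q' = 0" using bc by (metis mult.assoc mult_zero_right)
  have "b * u * a * (b * u) = b * (u * c) * u" by (simp add: c_def mult.assoc)
  then have 1: "b * u * a * (b * u) = b * u" by (simp add: uc bc)
  have 2: "p * (b * u) = b * u" using pb by (metis mult.assoc)
  have "b * u * a * b = b" using uc bc by (metis c_def mult.assoc)
  then have 3: "b * u * a * p = p" using ep by (metis mult.assoc)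
  have "(1 - q') * (1 - a * (b * u)) = 0"
    using qcu by (simp add: right_diff_distrib c_def mult.assoc)
  then have 5: "q' * (1 - a * (b * u)) = 1 - a * (b * u)" by (simp add: left_diff_distrib)
  show ?thesis unfolding is_outer_inv_l_iff[OF assms(1,3)] using 1 2 3 4 5 by blast
qed

section \<open>Neumann series and norm estimates\<close>

lemma one_minus_invertible:
  fixes x :: "'a::{real_normed_algebra, ring_1, banach}"
  assumes "norm x < 1"
  obtains u where "(1 - x) * u = 1" "u * (1 - x) = 1"
proof -
  \<comment> \<open>The exponent starts at 1 because \<open>norm 1\<close> may exceed 1, in which
    case the bound fails for \<open>x ^ 0\<close>.\<close>
  have "norm (x ^ Suc n) \<le> norm x ^ Suc n" for n
  proof (induction n)
    case (Suc n)
    have "norm (x * x ^ Suc n) \<le> norm x * norm (x ^ Suc n)" by (rule norm_mult_ineq)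
    also have "\<dots> \<le> norm x * norm x ^ Suc n" by (rule mult_left_mono[OF Suc]) simp
    finally show ?case by simp
  qed simp
  moreover have "summable (\<lambda>n. norm x ^ Suc n)"
    using summable_geometric[of "norm x"] assms
    by (simp only: summable_Suc_iff[of "\<lambda>n. norm x ^ n"]) simp
  ultimately have "summable (\<lambda>n. x ^ Suc n)" by (blast intro: summable_comparison_test')
  then have s: "summable (\<lambda>n. x ^ n)" by (simp only: summable_Suc_iff[of "\<lambda>n. x ^ n"])
  define u where "u = (\<Sum>n. x ^ n)"
  have h: "(\<Sum>n. x ^ Suc n) = u - 1"
    using suminf_split_head[OF s] by (simp add: u_def)
  have "(\<Sum>n. x ^ Suc n) = x * u" using suminf_mult[OF s] by (simp add: u_def)
  moreover have "(\<Sum>n. x ^ Suc n) = u * x"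
    using suminf_mult2[OF s] by (simp add: u_def power_Suc2 del: power_Suc)
  ultimately have "(1 - x) * u = 1" "u * (1 - x) = 1"
    using h by (simp_all add: algebra_simps)
  then show ?thesis by (rule that)
qed

lemma norm_fixed_point_le:
  fixes x y c :: "'a::real_normed_algebra"
  assumes "y = x * y + c" and "norm x \<le> d" and "d < 1"
  shows "norm y \<le> norm c / (1 - d)"
proof -
  have "norm y \<le> norm (x * y) + norm c" using norm_triangle_ineq assms(1) by metis
  also have "\<dots> \<le> norm x * norm y + norm c" by (simp add: norm_mult_ineq)
  also have "\<dots> \<le> d * norm y + norm c" using assms(2) by (simp add: mult_right_mono)
  finally show ?thesis using assms(3) by (simp add: field_simps)
qed

text \<open>Expanding the product before taking norms gives the constant \<open>1 + k\<close>;
  bounding \<open>norm (1 - e)\<close> by the triangle inequality would bring in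
  \<open>norm 1\<close>.\<close>

lemma norm_one_minus_mult_le:
  fixes e x :: "'a::{real_normed_algebra, ring_1}"
  assumes "norm e \<le> k"
  shows "norm ((1 - e) * x) \<le> (1 + k) * norm x" and "norm (x * (1 - e)) \<le> (1 + k) * norm x"
proof -
  have "norm (x - e * x) \<le> norm x + norm e * norm x"
    using norm_triangle_ineq4[of x "e * x"] norm_mult_ineq[of e x] by linarith
  moreover have "norm (x - x * e) \<le> norm x + norm x * norm e"
    using norm_triangle_ineq4[of x "x * e"] norm_mult_ineq[of x e] by linarith
  moreover have "norm e * norm x \<le> k * norm x" using assms by (simp add: mult_right_mono)
  ultimately show "norm ((1 - e) * x) \<le> (1 + k) * norm x"
    and "norm (x * (1 - e)) \<le> (1 + k) * norm x"
    by (simp_all add: algebra_simps)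
qed

section \<open>Existence of the perturbed inverse\<close>

lemma is_outer_inv_l_perturbation_exists:
  fixes a b p q p' q' :: "'a::{real_normed_algebra, ring_1, banach}" and k s t :: real
  assumes idem: "p * p = p" "q * q = q" "p' * p' = p'" "q' * q' = q'"
    and b: "is_outer_inv_l a p q b"
    and k: "k = norm a * norm b"
    and s: "norm (p - p') < 1 / (1 + k)\<^sup>2"
    and t: "norm (q - q') < 1 / (3 + k)"
  shows "outer_inv_l_exists a p' q'"
proof -
  have k0: "k \<ge> 0" by (simp add: k)
  have ba: "norm (b * a) \<le> k" using norm_mult_ineq[of b a] by (simp add: k mult.commute)
  \<comment> \<open>The square in the hypothesis makes \<open>d < 1 / (1 + k)\<close>, not merely
    \<open>d < 1\<close>. This is what later bounds \<open>k / (1 - d)\<close> by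
    \<open>1 + k\<close>.\<close>
  define d where "d = (1 + k) * norm (p - p')"
  have "d < (1 + k) * (1 / (1 + k)\<^sup>2)"
    unfolding d_def by (rule mult_strict_left_mono[OF s]) (use k0 in simp)
  also have "\<dots> = 1 / (1 + k)" using k0 by (simp add: power2_eq_square)
  finally have dk: "d < 1 / (1 + k)" .
  also have "\<dots> \<le> 1" using k0 by simp
  finally have d1: "d < 1" .
  have x: "norm ((1 - b * a) * (p' - p)) \<le> d"
    using norm_one_minus_mult_le(1)[OF ba, of "p' - p"] by (simp add: d_def norm_minus_commute)
  then obtain u where u: "(1 - (1 - b * a) * (p' - p)) * u = 1"
      "u * (1 - (1 - b * a) * (p' - p)) = 1"
    using one_minus_invertible d1 by (metis le_less_trans)
  have "norm ((p - p') * (b * a)) \<le> norm (p - p') * norm (b * a)" by (rule norm_mult_ineq)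
  also have "\<dots> \<le> norm (p - p') * (1 + k)" using ba by (intro mult_left_mono) auto
  also have "\<dots> < 1" using d1 by (simp add: d_def mult.commute)
  finally obtain z where "(1 - (p - p') * (b * a)) * z = 1"
    using one_minus_invertible by blast
  then have b1: "is_outer_inv_l a p' q (u * b)"
    by (rule is_outer_inv_l_change_range[OF idem(1-3) b u])
  define b1 where "b1 = u * b"
  \<comment> \<open>Read as a fixed point equation, this bounds \<open>b1\<close> without an
    estimate of \<open>norm u\<close>.\<close>
  have "(1 - (1 - b * a) * (p' - p)) * b1 = b"
    using u(1) by (simp add: b1_def flip: mult.assoc)
  then have "b1 = (1 - b * a) * (p' - p) * b1 + b" by (simp add: algebra_simps)
  then have "norm b1 \<le> norm b / (1 - d)" by (rule norm_fixed_point_le[OF _ x d1])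
  then have "norm a * norm b1 \<le> k / (1 - d)"
    by (metis k mult_left_mono norm_ge_zero times_divide_eq_right)
  also have "k / (1 - d) \<le> 1 + k"
  proof -
    have "d * (1 + k) < 1" using dk k0 by (simp add: field_simps)
    then show ?thesis using d1 by (simp add: field_simps)
  qed
  finally have ab1: "norm (a * b1) \<le> 1 + k" using norm_mult_ineq[of a b1] by linarith
  \<comment> \<open>The factor is \<open>1 + k\<close> from the general estimate, with
    \<open>k\<close> replaced by the bound \<open>1 + k\<close> on
    \<open>norm (a * b1)\<close>.\<close>
  have tk: "(1 + (1 + k)) * norm (q - q') < 1"
  proof -
    have "norm (q - q') * (3 + k) < 1" using t k0 by (simp add: field_simps)
    moreover have "(1 + (1 + k)) * norm (q - q') \<le> norm (q - q') * (3 + k)"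
      by (simp add: algebra_simps)
    ultimately show ?thesis by linarith
  qed
  have "norm ((q - q') * (1 - a * b1)) < 1"
    using norm_one_minus_mult_le(2)[OF ab1, of "q - q'"] tk by linarith
  then obtain u' where u': "(1 - (q - q') * (1 - a * b1)) * u' = 1"
      "u' * (1 - (q - q') * (1 - a * b1)) = 1"
    by (rule one_minus_invertible)
  have "norm (a * b1 * (q' - q)) \<le> norm (a * b1) * norm (q' - q)" by (rule norm_mult_ineq)
  also have "\<dots> \<le> (1 + (1 + k)) * norm (q' - q)" using ab1 by (intro mult_right_mono) auto
  also have "\<dots> < 1" using tk by (simp add: norm_minus_commute)
  finally obtain z where "z * (1 - a * b1 * (q' - q)) = 1"
    using one_minus_invertible by blast
  then have "is_outer_inv_l a p' q' (b1 * u')"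
    using b1 u' by (intro is_outer_inv_l_change_kernel[OF idem(3,2,4)]) (simp_all add: b1_def)
  then show ?thesis by (auto simp: outer_inv_l_exists_def)
qed

section \<open>Fixed point equation and final estimates\<close>

text \<open>Since \<open>1 - b * a\<close> kills \<open>p\<close> and \<open>p'\<close> fixes
  \<open>b'\<close>, the first term of the sum times \<open>b'\<close> is
  \<open>(1 - b * a) * b'\<close>. Since \<open>b\<close> kills \<open>q\<close> and
  \<open>q'\<close> fixes \<open>1 - a * b'\<close>, the second is
  \<open>b * (q' - 1 + a * b')\<close>. In their sum \<open>b * a * b'\<close> cancels.\<close>

lemma is_outer_inv_l_fixed_point:
  fixes a b b' p q p' q' :: "'a::ring_1"
  assumes idem: "p * p = p" "q * q = q" "p' * p' = p'" "q' * q' = q'"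
    and b: "is_outer_inv_l a p q b" and b': "is_outer_inv_l a p' q' b'"
  shows "b' = ((1 - b * a) * (p' - p) + b * (q' - q) * a) * b' + b * (1 - (q' - q))"
proof -
  have ep: "b * a * p = p" and bq: "b * q = 0"
    using b unfolding is_outer_inv_l_iff[OF idem(1,2)] by auto
  have pb': "p' * b' = b'" and qf': "q' * (1 - a * b') = 1 - a * b'"
    using b' unfolding is_outer_inv_l_iff[OF idem(3,4)] by auto
  have "(1 - b * a) * p = 0" by (simp add: left_diff_distrib ep)
  then have "(1 - b * a) * (p' - p) * b' = (1 - b * a) * b'"
    by (simp add: right_diff_distrib mult.assoc pb')
  moreover have "b * (q' - q) * a * b' = b * (q' * (a * b'))"
    by (simp add: right_diff_distrib bq mult.assoc)
  moreover have "q' * (a * b') = q' - 1 + a * b'" using qf' by (simp add: algebra_simps)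
  ultimately have "((1 - b * a) * (p' - p) + b * (q' - q) * a) * b' =
      (1 - b * a) * b' + b * (q' - 1 + a * b')"
    by (simp only: distrib_right)
  then show ?thesis by (simp add: algebra_simps bq)
qed

theorem theorem4p7:
  fixes a p q p' q' :: "'a::complex_banach_algebra_1" and \<kappa> :: real
  assumes "p * p = p" and "q * q = q" and "p' * p' = p'" and "q' * q' = q'"
    and "outer_inv_l_exists a p q"
    and "\<kappa> = norm a * norm (outer_inv_l a p q)"
    and "norm (p - p') < 1 / (1 + \<kappa>)\<^sup>2"
    and "norm (q - q') < 1 / (3 + \<kappa>)"
  shows "outer_inv_l_exists a p' q' \<and>
    norm (outer_inv_l a p' q' - outer_inv_l a p q) / norm (outer_inv_l a p q)
      \<le> (1 + \<kappa>) * (norm (p - p') + norm (q - q'))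
          / (1 - (1 + \<kappa>) * norm (p - p') - \<kappa> * norm (q - q')) \<and>
    norm (outer_inv_l a p' q')
      \<le> (1 + norm (q - q')) * norm (outer_inv_l a p q)
          / (1 - (1 + \<kappa>) * norm (p - p') - \<kappa> * norm (q - q'))"
proof -
  define b b' where "b = outer_inv_l a p q" and "b' = outer_inv_l a p' q'"
  define s t where "s = norm (p - p')" and "t = norm (q - q')"
  define X where "X = (1 - b * a) * (p' - p) + b * (q' - q) * a"
  note idem = assms(1-4)
  have b: "is_outer_inv_l a p q b"
    unfolding b_def by (rule is_outer_inv_l_outer_inv_l[OF assms(5)])
  have k: "\<kappa> = norm a * norm b" using assms(6) by (simp add: b_def)
  have ex: "outer_inv_l_exists a p' q'"
    by (rule is_outer_inv_l_perturbation_exists[OF idem b k assms(7,8)])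
  then have b': "is_outer_inv_l a p' q' b'"
    unfolding b'_def by (rule is_outer_inv_l_outer_inv_l)
  have k0: "\<kappa> \<ge> 0" and s0: "s \<ge> 0" and t0: "t \<ge> 0" by (simp_all add: k s_def t_def)
  have ba: "norm (b * a) \<le> \<kappa>" and ab: "norm (a * b) \<le> \<kappa>"
    using norm_mult_ineq[of b a] norm_mult_ineq[of a b] by (simp_all add: k mult.commute)
  have d1: "(1 + \<kappa>) * s + \<kappa> * t < 1"
  proof -
    have "(1 + \<kappa>) * s < (1 + \<kappa>) * (1 / (1 + \<kappa>)\<^sup>2)"
      using assms(7) k0 unfolding s_def by (intro mult_strict_left_mono) auto
    also have "\<dots> = 1 / (1 + \<kappa>)" using k0 by (simp add: power2_eq_square)
    finally have "(1 + \<kappa>) * s < 1 / (1 + \<kappa>)" .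
    moreover have "\<kappa> * t \<le> \<kappa> * (1 / (3 + \<kappa>))"
      using assms(8) k0 unfolding t_def by (intro mult_left_mono) auto
    \<comment> \<open>The two terms are compared with the splitting of 1 into
      \<open>3 / (3 + \<kappa>)\<close> and \<open>\<kappa> / (3 + \<kappa>)\<close>.\<close>
    moreover have "1 / (1 + \<kappa>) \<le> 3 / (3 + \<kappa>)" using k0 by (simp add: field_simps)
    moreover have "3 / (3 + \<kappa>) + \<kappa> * (1 / (3 + \<kappa>)) = 1"
      using k0 by (simp flip: add_divide_distrib)
    ultimately show ?thesis by linarith
  qed
  have e: "norm ((1 - b * a) * (p' - p)) \<le> (1 + \<kappa>) * s"
    using norm_one_minus_mult_le(1)[OF ba, of "p' - p"] by (simp add: s_def norm_minus_commute)
  have bt: "norm (b * (q' - q)) \<le> norm b * t"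
    using norm_mult_ineq[of b "q' - q"] by (simp add: t_def norm_minus_commute)
  have "norm (b * (q' - q) * a) \<le> norm (b * (q' - q)) * norm a" by (rule norm_mult_ineq)
  also have "\<dots> \<le> norm b * t * norm a" by (rule mult_right_mono[OF bt]) simp
  finally have "norm (b * (q' - q) * a) \<le> \<kappa> * t" by (simp add: k ac_simps)
  with e have X: "norm X \<le> (1 + \<kappa>) * s + \<kappa> * t"
    unfolding X_def by (rule norm_triangle_mono)
  have fp: "b' = X * b' + b * (1 - (q' - q))"
    unfolding X_def by (rule is_outer_inv_l_fixed_point[OF idem b b'])
  have "norm (b * (1 - (q' - q))) \<le> (1 + t) * norm b"
    using norm_triangle_ineq4[of b "b * (q' - q)"] bt by (simp add: algebra_simps)
  with norm_fixed_point_le[OF fp X d1]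
  have bound': "norm b' \<le> (1 + t) * norm b / (1 - (1 + \<kappa>) * s - \<kappa> * t)"
    using d1 by (simp add: divide_simps algebra_simps)
  \<comment> \<open>This is the residual of \<open>b\<close> in the fixed point equation for
    \<open>b'\<close>. The terms containing \<open>q' - q\<close> combine into the factor
    \<open>1 - a * b\<close>, which gives both summands the coefficient
    \<open>1 + \<kappa>\<close>.\<close>
  define r where "r = (1 - b * a) * (p' - p) * b - b * (q' - q) * (1 - a * b)"
  have "b' - b = X * b' - b * (q' - q)"
    using fp by (simp add: algebra_simps)
  also have "\<dots> = X * (b' - b) + (X * b - b * (q' - q))"
    by (simp add: right_diff_distrib)
  also have "X * b - b * (q' - q) = r"
    by (simp add: X_def r_def distrib_right right_diff_distrib[of _ 1] mult.assoc)
  finally have fp2: "b' - b = X * (b' - b) + r" .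
  have "norm ((1 - b * a) * (p' - p) * b) \<le> (1 + \<kappa>) * s * norm b"
    by (rule order_trans[OF norm_mult_ineq mult_right_mono[OF e]]) simp
  moreover have "norm (b * (q' - q) * (1 - a * b)) \<le> (1 + \<kappa>) * (norm b * t)"
    by (rule order_trans[OF norm_one_minus_mult_le(2)[OF ab] mult_left_mono[OF bt]])
      (use k0 in simp)
  ultimately have "norm r \<le> (1 + \<kappa>) * (s + t) * norm b"
    unfolding r_def by (intro order_trans[OF norm_triangle_ineq4]) (simp add: algebra_simps)
  with norm_fixed_point_le[OF fp2 X d1]
  have bound: "norm (b' - b) \<le> (1 + \<kappa>) * (s + t) / (1 - (1 + \<kappa>) * s - \<kappa> * t) * norm b"
    using d1 by (simp add: divide_simps algebra_simps)
  have "norm (b' - b) / norm b \<le> (1 + \<kappa>) * (s + t) / (1 - (1 + \<kappa>) * s - \<kappa> * t)"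
  proof (cases "b = 0")
    \<comment> \<open>Division by zero yields 0, so the left side vanishes and only nonnegativity of
      the right side remains.\<close>
    case True
    then show ?thesis using k0 s0 t0 d1 by simp
  next
    case False
    then show ?thesis using bound by (simp add: pos_divide_le_eq)
  qed
  with ex bound' show ?thesis unfolding b_def b'_def s_def t_def by blast
qed

end
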